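(* Let $\theta\in(0,\pi)$ with $\sin 2\theta\neq 0$, $\lambda_0=2\cos\theta$, $\rho=\frac{1}{2\sin\theta}$. Let $(\omega_j)_{j\ge1}$ be i.i.d. real random variables with $\mathbb{E}\omega_j=0$, $\mathbb{E}\omega_j^2=1$ and $|\omega_j|<c_0$ almost surely. Let $0<\sigma\le \frac{2\sin\theta\,|\sin2\theta|}{460c_0^3}$ and $0\le \kappa\le 6c_0^3\rho^3\sigma^3/|\sin2\theta|$. Then for every $B>0$, $$\mathbb{P}\big(\exists\, n\ge1:\ (\log Y_n+\kappa n)-(\log Y_1+\kappa)\ge B\big)\le 2\exp\!\Big(-B\Big(1-\frac{230c_0^3\sigma}{2\sin\theta\,|\sin2\theta|}\Big)\Big).$$
   Context: Let $z=e^{i\theta}$, $T_i=\begin{pmatrix}\lambda_0-\sigma\omega_i&-1\\1&0\end{pmatrix}$, $W_k=T_k\cdots T_1$, and define $X_k,Y_k\in\mathbb{R}$, $Y_k>0$, by $X_k+iY_k=W_k^{-1}\circ z$, where a real $2\times2$ matrix $\begin{pmatrix}a&b\\c&d\end{pmatrix}$ of positive determinant acts on the upper half plane by $w\mapsto\frac{aw+b}{cw+d}$. *)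

theory Defs
  imports "HOL-Probability.Probability"
begin

definition Tmat :: "real \<Rightarrow> real \<Rightarrow> real \<Rightarrow> real^2^2" where
  "Tmat lam0 sig w = vector [vector [lam0 - sig * w, -1], vector [1, 0]]"

fun Wmat :: "real \<Rightarrow> real \<Rightarrow> (nat \<Rightarrow> real) \<Rightarrow> nat \<Rightarrow> real^2^2" where
  "Wmat lam0 sig om 0 = mat 1"
| "Wmat lam0 sig om (Suc k) = Tmat lam0 sig (om (Suc k)) ** Wmat lam0 sig om k"

definition mobius :: "real^2^2 \<Rightarrow> complex \<Rightarrow> complex" where
  "mobius A w = (of_real (A$1$1) * w + of_real (A$1$2)) / (of_real (A$2$1) * w + of_real (A$2$2))"

definition Yk :: "real \<Rightarrow> real \<Rightarrow> real \<Rightarrow> (nat \<Rightarrow> real) \<Rightarrow> nat \<Rightarrow> real" where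
  "Yk theta lam0 sig om k = Im (mobius (matrix_inv (Wmat lam0 sig om k)) (cis theta))"

end

theory Submission
  imports Defs
begin

text \<open>
  With \<open>z = cis \<theta>\<close> and first column \<open>(a, c)\<close> of \<open>W\<^sub>n\<close>, put \<open>\<eta>\<^sub>n = cnj z * a - c\<close>. Then \<open>Y\<^sub>n = sin \<theta> / |\<eta>\<^sub>n|\<^sup>2\<close>
  and \<open>\<eta>\<^sub>n\<^sub>+\<^sub>1 = cnj z * (\<eta>\<^sub>n + 2 s \<omega>\<^sub>n\<^sub>+\<^sub>1 Im \<eta>\<^sub>n)\<close> with \<open>s = \<rho> \<sigma>\<close>. For \<open>p\<close> slightly below 1 and
  \<open>\<eta> = r e\<^sup>i\<^sup>\<phi>\<close>, the conditional mean of \<open>|\<eta>|\<^sup>-\<^sup>2\<^sup>p\<close> is multiplied in one step by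
  \<open>1 + s\<^sup>2 (2p cos 2\<phi> - p(p+1) cos 4\<phi> - p(1-p)) + O(s\<^sup>3)\<close>. Since the unperturbed dynamics rotates \<open>2\<phi>\<close> by
  \<open>-2\<theta>\<close>, the two oscillating terms form a coboundary as long as \<open>sin 2\<theta> \<noteq> 0\<close>, and a factor
  \<open>1 + s\<^sup>2 g(e\<^sup>2\<^sup>i\<^sup>\<phi>)\<close> removes them. The remaining negative drift \<open>-p(1-p) s\<^sup>2\<close> absorbs the cubic error
  and \<open>\<kappa>\<close>, so \<open>|\<eta>\<^sub>n|\<^sup>-\<^sup>2\<^sup>p e\<^sup>p\<^sup>\<kappa>\<^sup>n (1 + s\<^sup>2 g)\<close> is a nonnegative supermartingale, to which the maximal
  inequality applies.
\<close>

section \<open>Maximal inequality for random recursions\<close>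

text \<open>The state with index n has consumed the inputs 1 to n + 1. Index 0 already uses
  \<open>om 1\<close>, because the event measures growth relative to Y_1 and not to Y_0.\<close>

fun chain :: "('b \<Rightarrow> real \<Rightarrow> 'b) \<Rightarrow> (real \<Rightarrow> 'b) \<Rightarrow> (nat \<Rightarrow> real) \<Rightarrow> nat \<Rightarrow> 'b" where
  "chain F i om 0 = i (om 1)"
| "chain F i om (Suc n) = F (chain F i om n) (om (Suc (Suc n)))"

lemma chain_restrict: "chain F i (restrict om {1..Suc n}) n = chain F i om n"
proof -
  \<comment> \<open>The restriction set stays fixed at N while n varies; were it tied to n, the
    induction hypothesis would concern another restriction.\<close>
  have "n \<le> N \<Longrightarrow> chain F i (restrict om {1..Suc N}) n = chain F i om n" for N
    by (induction n) auto
  then show ?thesis by simp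
qed

text \<open>The inputs form a family over an arbitrary space, so that this covers both random
  variables on \<open>M\<close> and the coordinates of a finite product of real lines.\<close>

lemma measurable_chain:
  assumes F: "(\<lambda>(s, w). F s w) \<in> borel_measurable (borel \<Otimes>\<^sub>M borel)"
    and i: "i \<in> borel_measurable borel"
    and X: "\<And>j. j \<in> {1..Suc n} \<Longrightarrow> (\<lambda>x. X x j) \<in> borel_measurable N"
  shows "(\<lambda>x. chain F i (X x) n) \<in> borel_measurable N"
  using X
proof (induction n)
  case 0
  then show ?case using measurable_compose[OF _ i] by simp
next
  case (Suc n)
  have "(\<lambda>x. (chain F i (X x) n, X x (Suc (Suc n)))) \<in> N \<rightarrow>\<^sub>M borel \<Otimes>\<^sub>M borel"
    using Suc by (intro measurable_Pair) auto
  from measurable_compose[OF this F] show ?case by simp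
qed

context prob_space
begin

text \<open>Inputs 1 to n + 1 determine the state and are independent of input n + 2, so the joint
  law is a product. Tonelli's theorem integrates the new input first, with the state held constant,
  where \<open>step\<close> applies. This takes the place of conditional expectations.\<close>

lemma nn_integral_chain_le:
  assumes F: "(\<lambda>(s, w). F s w) \<in> borel_measurable (borel \<Otimes>\<^sub>M borel)"
    and i: "i \<in> borel_measurable borel"
    and X: "indep_vars (\<lambda>_. borel) X {1..}"
    and V: "V \<in> borel_measurable borel"
    and step: "\<And>s j. (\<integral>\<^sup>+x. V (F s (X (Suc j) x)) \<partial>M) \<le> V s"
  shows "(\<integral>\<^sup>+x. V (chain F i (\<lambda>j. X j x) n) \<partial>M) \<le> (\<integral>\<^sup>+x. V (i (X 1 x)) \<partial>M)"
proof (induction n)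
  case (Suc n)
  let ?k = "Suc (Suc n)"
  let ?P = "PiM {1..Suc n} (\<lambda>_. borel :: real measure)" and ?Q = "PiM {?k} (\<lambda>_. borel :: real measure)"
  let ?R = "\<lambda>x. restrict (\<lambda>j. X j x) {1..Suc n}" and ?T = "\<lambda>x. restrict (\<lambda>j. X j x) {?k}"
  have "indep_var ?P ?R ?Q ?T" by (rule indep_var_restrict[OF X]) auto
  then have R: "?R \<in> M \<rightarrow>\<^sub>M ?P" and T: "?T \<in> M \<rightarrow>\<^sub>M ?Q"
    and eq: "distr M ?P ?R \<Otimes>\<^sub>M distr M ?Q ?T = distr M (?P \<Otimes>\<^sub>M ?Q) (\<lambda>x. (?R x, ?T x))"
    unfolding indep_var_distribution_eq by auto
  interpret T: prob_space "distr M ?Q ?T" using T by (rule prob_space_distr)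
  have C: "(\<lambda>r. chain F i r n) \<in> borel_measurable ?P"
    by (rule measurable_chain[OF F i]) (rule measurable_component_singleton)
  have t: "(\<lambda>t. t ?k) \<in> borel_measurable ?Q"
    by (rule measurable_component_singleton) simp
  have "(\<lambda>y. (chain F i (fst y) n, snd y ?k)) \<in> ?P \<Otimes>\<^sub>M ?Q \<rightarrow>\<^sub>M borel \<Otimes>\<^sub>M borel"
    by (intro measurable_Pair measurable_compose[OF measurable_fst C] measurable_compose[OF measurable_snd t])
  from measurable_compose[OF measurable_compose[OF this F] V]
  have VF: "(\<lambda>(r, t). V (F (chain F i r n) (t ?k))) \<in> borel_measurable (?P \<Otimes>\<^sub>M ?Q)"
    by (simp add: case_prod_beta')
  have VFs: "(\<lambda>t. V (F s (t ?k))) \<in> borel_measurable ?Q" for s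
  proof -
    have "(\<lambda>t. (s, t ?k)) \<in> ?Q \<rightarrow>\<^sub>M borel \<Otimes>\<^sub>M borel"
      using t by (intro measurable_Pair) auto
    from measurable_compose[OF measurable_compose[OF this F] V] show ?thesis by simp
  qed
  have "(\<integral>\<^sup>+x. V (chain F i (\<lambda>j. X j x) (Suc n)) \<partial>M)
      = (\<integral>\<^sup>+x. (case (?R x, ?T x) of (r, t) \<Rightarrow> V (F (chain F i r n) (t ?k))) \<partial>M)"
    unfolding chain_restrict prod.case chain.simps by simp
  also have "\<dots> = (\<integral>\<^sup>+y. (case y of (r, t) \<Rightarrow> V (F (chain F i r n) (t ?k))) \<partial>distr M (?P \<Otimes>\<^sub>M ?Q) (\<lambda>x. (?R x, ?T x)))"
    using R T VF by (intro nn_integral_distr[symmetric] measurable_Pair) auto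
  also have "\<dots> = (\<integral>\<^sup>+r. \<integral>\<^sup>+t. V (F (chain F i r n) (t ?k)) \<partial>distr M ?Q ?T \<partial>distr M ?P ?R)"
    unfolding eq[symmetric]
  proof (subst T.nn_integral_fst[symmetric])
    show "(\<lambda>(r, t). V (F (chain F i r n) (t ?k))) \<in> borel_measurable (distr M ?P ?R \<Otimes>\<^sub>M distr M ?Q ?T)"
      unfolding eq using VF by simp
  qed simp
  also have "\<dots> = (\<integral>\<^sup>+r. \<integral>\<^sup>+x. V (F (chain F i r n) (?T x ?k)) \<partial>M \<partial>distr M ?P ?R)"
    using VFs by (intro nn_integral_cong nn_integral_distr[OF T]) simp
  also have "\<dots> = (\<integral>\<^sup>+r. \<integral>\<^sup>+x. V (F (chain F i r n) (X ?k x)) \<partial>M \<partial>distr M ?P ?R)"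
    by simp
  also have "\<dots> \<le> (\<integral>\<^sup>+r. V (chain F i r n) \<partial>distr M ?P ?R)"
    by (intro nn_integral_mono step)
  also have "\<dots> = (\<integral>\<^sup>+x. V (chain F i (\<lambda>j. X j x) n) \<partial>M)"
    using measurable_compose[OF C V] by (subst nn_integral_distr[OF R]) (simp_all only: chain_restrict measurable_distr_eq1)
  finally show ?case using Suc by simp
qed simp

text \<open>Ville's maximal inequality for the supermartingale \<open>V (chain F i X n)\<close>:
  freeze the chain once it has entered \<open>A\<close> and apply Markov's inequality to the frozen chain.\<close>

lemma prob_chain_hits_le:
  fixes L K :: real
  assumes F: "(\<lambda>(s, w). F s w) \<in> borel_measurable (borel \<Otimes>\<^sub>M borel)"
    and i: "i \<in> borel_measurable borel"
    and X: "indep_vars (\<lambda>_. borel) X {1..}"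
    and V: "V \<in> borel_measurable borel"
    and step: "\<And>s j. (\<integral>\<^sup>+x. V (F s (X (Suc j) x)) \<partial>M) \<le> V s"
    and A: "A \<in> sets borel"
    and L: "0 < L" "\<And>s. s \<in> A \<Longrightarrow> ennreal L \<le> V s"
    and K: "0 \<le> K" "\<And>w. V (i w) \<le> ennreal K"
  shows "prob {x \<in> space M. \<exists>n. chain F i (\<lambda>j. X j x) n \<in> A} \<le> K / L"
proof -
  define F' where "F' s w = (if s \<in> A then s else F s w)" for s w
  let ?S = "\<lambda>n x. chain F' i (\<lambda>j. X j x) n"
  have F': "(\<lambda>(s, w). F' s w) \<in> borel_measurable (borel \<Otimes>\<^sub>M borel)"
  proof -
    have "(\<lambda>y. if fst y \<in> A then fst y else (case y of (s, w) \<Rightarrow> F s w)) \<in> borel_measurable (borel \<Otimes>\<^sub>M borel)"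
      using F A by (intro measurable_If measurable_fst) (auto simp: pred_def[symmetric] intro!: measurable_compose[OF measurable_fst] pred_sets1)
    moreover have "(\<lambda>y. if fst y \<in> A then fst y else (case y of (s, w) \<Rightarrow> F s w)) = (\<lambda>(s, w). F' s w)"
      by (auto simp: F'_def)
    ultimately show ?thesis by simp
  qed
  have step': "(\<integral>\<^sup>+x. V (F' s (X (Suc j) x)) \<partial>M) \<le> V s" for s j
    using step[of s j] by (cases "s \<in> A") (simp_all add: F'_def emeasure_space_1)
  have S[measurable]: "?S n \<in> borel_measurable M" for n
    using X by (intro measurable_chain[OF F' i]) (auto simp: indep_vars_def)
  define E where "E n = {x \<in> space M. ?S n x \<in> A}" for n
  have E: "E n \<in> sets M" for n unfolding E_def using A S by measurable
  have bound: "prob (E n) \<le> K / L" for n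
  proof -
    have "ennreal L * emeasure M (E n) = (\<integral>\<^sup>+x. ennreal L * indicator (E n) x \<partial>M)"
      using E by (simp add: nn_integral_cmult_indicator)
    also have "\<dots> \<le> (\<integral>\<^sup>+x. V (?S n x) \<partial>M)"
      by (intro nn_integral_mono) (auto simp: E_def indicator_def L)
    also have "\<dots> \<le> (\<integral>\<^sup>+x. V (i (X 1 x)) \<partial>M)"
      by (rule nn_integral_chain_le[OF F' i X V step'])
    also have "\<dots> \<le> (\<integral>\<^sup>+x. ennreal K \<partial>M)" by (intro nn_integral_mono K)
    also have "\<dots> = ennreal K" by (simp add: emeasure_space_1)
    finally have "ennreal (L * prob (E n)) \<le> ennreal K"
      using L by (simp add: emeasure_eq_measure ennreal_mult)
    then show ?thesis using K(1) L(1) by (simp add: field_simps)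
  qed
  have hit: "(\<exists>n. chain F i om n \<in> A) \<longleftrightarrow> (\<exists>n. chain F' i om n \<in> A)" for om
  proof -
    have a: "chain F' i om n = chain F i om n \<or> (\<exists>m. chain F i om m \<in> A) \<and> chain F' i om n \<in> A" for n
      by (induction n) (auto simp: F'_def)
    have b: "(\<forall>m<n. chain F i om m \<notin> A) \<Longrightarrow> chain F' i om n = chain F i om n" for n
      by (induction n) (auto simp: F'_def)
    show ?thesis
    proof
      assume "\<exists>n. chain F i om n \<in> A"
      then obtain n where "chain F i om n \<in> A" "\<forall>m<n. chain F i om m \<notin> A"
        using exists_least_iff[of "\<lambda>n. chain F i om n \<in> A"] by auto
      then show "\<exists>n. chain F' i om n \<in> A" using b[of n] by metis
    qed (use a in metis)
  qed
  \<comment> \<open>Freezing makes the events increase, so continuity from below extends the bound,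
    which is uniform in n, to their union.\<close>
  have "incseq E" unfolding E_def by (intro incseq_SucI) (auto simp: F'_def)
  then have "(\<lambda>n. prob (E n)) \<longlonglongrightarrow> prob (\<Union>n. E n)"
    using E by (intro finite_Lim_measure_incseq) auto
  then have "prob (\<Union>n. E n) \<le> K / L" using bound by (intro LIMSEQ_le_const2) auto
  moreover have "(\<Union>n. E n) = {x \<in> space M. \<exists>n. chain F i (\<lambda>j. X j x) n \<in> A}"
    using hit by (auto simp: E_def)
  ultimately show ?thesis by simp
qed

end

section \<open>The orbit of the transfer matrices\<close>

text \<open>\<open>phase\<close> is the sequence \<open>\<eta>\<^sub>n\<close> of the introduction.\<close>

fun phase :: "real \<Rightarrow> real \<Rightarrow> (nat \<Rightarrow> real) \<Rightarrow> nat \<Rightarrow> complex" where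
  "phase \<theta> s om 0 = cis (-\<theta>)"
| "phase \<theta> s om (Suc n) = cis (-\<theta>) * (phase \<theta> s om n + of_real (2 * s * om (Suc n) * Im (phase \<theta> s om n)))"

text \<open>The first column evolves from (a, c) to ((2 cos \<theta> - \<sigma> \<omega>) a - c, a).
  Since \<open>cis (-\<theta>)\<close> solves x^2 = 2 cos \<theta> x - 1, the noiseless step
  multiplies \<eta> by it. As Im \<eta> = - a sin \<theta>, the noise term - \<sigma> \<omega> a is
  2 s \<omega> Im \<eta>.\<close>

lemma phase_eq:
  assumes "sin \<theta> \<noteq> 0"
  shows "phase \<theta> (\<sigma> / (2 * sin \<theta>)) om n
    = cis (-\<theta>) * of_real (Wmat (2 * cos \<theta>) \<sigma> om n $ 1 $ 1) - of_real (Wmat (2 * cos \<theta>) \<sigma> om n $ 2 $ 1)"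
proof (induction n)
  case 0
  show ?case by (simp add: mat_def)
next
  case (Suc n)
  define a c where "a = Wmat (2 * cos \<theta>) \<sigma> om n $ 1 $ 1" and "c = Wmat (2 * cos \<theta>) \<sigma> om n $ 2 $ 1"
  have IH: "phase \<theta> (\<sigma> / (2 * sin \<theta>)) om n = cis (-\<theta>) * of_real a - of_real c"
    using Suc by (simp add: a_def c_def)
  have W: "Wmat (2 * cos \<theta>) \<sigma> om (Suc n) $ 1 $ 1 = (2 * cos \<theta> - \<sigma> * om (Suc n)) * a - c"
    "Wmat (2 * cos \<theta>) \<sigma> om (Suc n) $ 2 $ 1 = a"
    by (simp_all add: Tmat_def matrix_matrix_mult_def sum_2 a_def c_def)
  have Im: "Im (phase \<theta> (\<sigma> / (2 * sin \<theta>)) om n) = - a * sin \<theta>" unfolding IH by simp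
  have z2: "cis (-\<theta>) * cis (-\<theta>) = of_real (2 * cos \<theta>) * cis (-\<theta>) - 1"
    by (simp add: complex_eq_iff) (use sin_cos_squared_add[of \<theta>] in algebra)
  have "phase \<theta> (\<sigma> / (2 * sin \<theta>)) om (Suc n)
      = cis (-\<theta>) * (cis (-\<theta>) * of_real a - of_real c - of_real (\<sigma> * om (Suc n) * a))"
    unfolding phase.simps Im IH using assms by (simp add: algebra_simps)
  also have "\<dots> = (cis (-\<theta>) * cis (-\<theta>)) * of_real a - cis (-\<theta>) * (of_real c + of_real (\<sigma> * om (Suc n) * a))"
    by (simp add: algebra_simps)
  also have "\<dots> = cis (-\<theta>) * of_real ((2 * cos \<theta> - \<sigma> * om (Suc n)) * a - c) - of_real a"
    unfolding z2 by (simp add: algebra_simps)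
  finally show ?case unfolding W .
qed

lemma det_Wmat: "det (Wmat lam \<sigma> om n) = 1"
  by (induction n) (simp_all add: det_mul, simp add: det_2 Tmat_def)

text \<open>\<open>matrix_inv\<close> is defined by choice. Its value follows by cancellation: the
  adjugate is a left inverse and the chosen matrix a right inverse.\<close>

lemma matrix_inv_unimodular_2:
  fixes W :: "real^2^2"
  assumes "det W = 1"
  shows "matrix_inv W = vector [vector [W$2$2, - W$1$2], vector [- W$2$1, W$1$1]]" (is "_ = ?B")
proof -
  have B: "?B ** W = mat 1"
    using assms by (simp add: vec_eq_iff forall_2 matrix_matrix_mult_def sum_2 mat_def det_2 algebra_simps)
  have "invertible W" using assms by (simp add: invertible_det_nz)
  then have "W ** matrix_inv W = mat 1"
    unfolding matrix_inv_def invertible_def by (rule someI2_ex) blast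
  then have "?B ** W ** matrix_inv W = ?B" by (simp flip: matrix_mul_assoc)
  then show ?thesis unfolding B by simp
qed

text \<open>A real matrix of determinant 1 divides Im z by |c z + d|^2. For the inverse of W this
  denominator is W_11 - W_21 z, which is \<eta> times the unimodular z.\<close>

lemma Yk_eq:
  assumes "sin \<theta> \<noteq> 0"
  shows "Yk \<theta> (2 * cos \<theta>) \<sigma> om n = sin \<theta> / (norm (phase \<theta> (\<sigma> / (2 * sin \<theta>)) om n))\<^sup>2"
proof -
  define W where "W = Wmat (2 * cos \<theta>) \<sigma> om n"
  have det: "W$1$1 * W$2$2 - W$1$2 * W$2$1 = 1" using det_Wmat by (simp add: W_def flip: det_2)
  have "norm (phase \<theta> (\<sigma> / (2 * sin \<theta>)) om n)
      = norm (cis \<theta> * (cis (-\<theta>) * of_real (W$1$1) - of_real (W$2$1)))"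
    unfolding norm_mult[of "cis \<theta>"] phase_eq[OF assms] W_def by simp
  also have "cis \<theta> * (cis (-\<theta>) * of_real (W$1$1) - of_real (W$2$1)) = - of_real (W$2$1) * cis \<theta> + of_real (W$1$1)"
    by (simp add: algebra_simps cis_mult flip: mult.assoc)
  finally have n: "(norm (phase \<theta> (\<sigma> / (2 * sin \<theta>)) om n))\<^sup>2 = (W$1$1 - W$2$1 * cos \<theta>)\<^sup>2 + (W$2$1 * sin \<theta>)\<^sup>2"
    by (simp add: cmod_power2)
  have "Yk \<theta> (2 * cos \<theta>) \<sigma> om n = ((W$1$1 * W$2$2 - W$1$2 * W$2$1) * sin \<theta>) / ((W$1$1 - W$2$1 * cos \<theta>)\<^sup>2 + (W$2$1 * sin \<theta>)\<^sup>2)"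
    unfolding Yk_def mobius_def W_def[symmetric] matrix_inv_unimodular_2[OF det_Wmat[of "2 * cos \<theta>" \<sigma> om n, folded W_def]]
    by (simp add: Im_divide algebra_simps)
  then show ?thesis unfolding n det by simp
qed

text \<open>Adding a real multiple of Im z is a shear: it keeps the imaginary part, and it fixes z
  if that part vanishes.\<close>

lemma phase_nonzero: "phase \<theta> s om n \<noteq> 0"
proof (induction n)
  case (Suc n)
  have "z + of_real (r * Im z) \<noteq> 0" if "z \<noteq> 0" for z and r :: real
    using that by (auto simp: complex_eq_iff)
  from this[OF Suc, of "2 * s * om (Suc n)"] show ?case by simp
qed simp

section \<open>The Lyapunov function\<close>

text \<open>Taylor's formula with Lagrange remainder. The remainder coefficient is at most
  (p(p+1)(p+2)/6) (99/100)^(-4), hence at most 2.\<close>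

lemma one_plus_powr_minus_upper_bound:
  fixes p x :: real
  assumes p: "0 \<le> p" "p \<le> 1" and x: "\<bar>x\<bar> \<le> 1/100"
  shows "(1 + x) powr (-p) \<le> 1 - p * x + p * (p + 1) / 2 * x\<^sup>2 + 2 * \<bar>x\<bar>^3"
proof (cases "x = 0")
  case False
  \<comment> \<open>\<open>d m\<close> is the derivative of order m of (1 + t)^(-p); the last branch
    stands for m = 3.\<close>
  define d where "d m t = (if m = 0 then (1 + t) powr (-p)
     else if m = 1 then (-p) * (1 + t) powr (-p-1)
     else if m = 2 then (p * (p+1)) * (1 + t) powr (-p-2)
     else (-(p * (p+1) * (p+2))) * (1 + t) powr (-p-3))" for m :: nat and t :: real
  have "\<exists>t. (if x < 0 then x < t \<and> t < 0 else 0 < t \<and> t < x) \<and>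
      (1 + x) powr (-p) = (\<Sum>m<3. d m 0 / fact m * (x - 0)^m) + d 3 t / fact 3 * (x - 0)^3"
  proof (rule Taylor[where a = "-1/100" and b = "1/100"])
    show "\<forall>m t. m < 3 \<and> - 1 / 100 \<le> t \<and> t \<le> 1 / 100 \<longrightarrow> (d m has_real_derivative d (Suc m) t) (at t)"
    proof (intro allI impI)
      fix m :: nat and t :: real assume a: "m < 3 \<and> - 1 / 100 \<le> t \<and> t \<le> 1 / 100"
      then consider "m = 0" | "m = 1" | "m = 2" by linarith
      then show "(d m has_real_derivative d (Suc m) t) (at t)"
      proof cases
        case 1 
        then show ?thesis using a unfolding d_def by (auto intro!: derivative_eq_intros)
      next
        case 2 
        then show ?thesis using a unfolding d_def 
          by (auto intro!: derivative_eq_intros simp: algebra_simps)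
      next
        case 3 
        then show ?thesis using a unfolding d_def 
          by (auto intro!: derivative_eq_intros simp: algebra_simps)
      qed
    qed
  qed (use x False in \<open>auto simp: d_def\<close>)
  then obtain t where t: "if x < 0 then x < t \<and> t < 0 else 0 < t \<and> t < x"
    and eq: "(1 + x) powr (-p) = (\<Sum>m<3. d m 0 / fact m * (x - 0)^m) + d 3 t / fact 3 * (x - 0)^3"
    by blast
  have tb: "99/100 \<le> 1 + t" using t x by (auto split: if_splits)
  have "(1 + t) powr (-p-3) \<le> (99/100) powr (-p-3)"
    using tb p by (intro powr_mono2') auto
  also have "\<dots> \<le> (99/100) powr (-4)"
    using p by (intro powr_mono') auto
  also have "\<dots> = 1 / (99/100)^4" by (simp add: powr_minus_divide powr_numeral)
  also have "\<dots> \<le> 2" by (simp add: power_divide)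
  finally have u: "(1 + t) powr (-p-3) \<le> 2" .
  have "p * (p+1) * (p+2) \<le> 1 * 2 * 3" using p by (intro mult_mono) auto
  then have "p * (p+1) * (p+2) * (1 + t) powr (-p-3) \<le> 6 * 2"
    using u p by (intro mult_mono) auto
  moreover have "0 \<le> p * (p+1) * (p+2) * (1 + t) powr (-p-3)" using p by simp
  ultimately have "\<bar>d 3 t / fact 3\<bar> \<le> 2"
    by (simp add: d_def fact_numeral abs_mult)
  then have "\<bar>d 3 t / fact 3\<bar> * \<bar>x\<bar>^3 \<le> 2 * \<bar>x\<bar>^3"
    by (intro mult_right_mono) auto
  then have "d 3 t / fact 3 * x^3 \<le> 2 * \<bar>x\<bar>^3"
    by (metis abs_ge_self abs_mult order_trans power_abs)
  moreover have "(\<Sum>m<3. d m 0 / fact m * (x - 0)^m) = 1 - p * x + p * (p + 1) / 2 * x\<^sup>2"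
    by (simp add: d_def eval_nat_numeral)
  ultimately show ?thesis using eq by simp
qed simp

text \<open>With e = s \<omega> and \<phi> the argument of \<eta>, 1 + x is the factor by which one
  step multiplies |\<eta>|^2. The terms are sorted by powers of e: the square of x leaves 17 |e|^3
  and the Taylor remainder 18 |e|^3, together below 40 |e|^3.\<close>

lemma growth_powr_upper_bound:
  fixes p e \<phi> :: real
  assumes p: "0 \<le> p" "p \<le> 1" and e: "\<bar>e\<bar> \<le> 1/460"
  defines "x \<equiv> 2 * e * sin (2 * \<phi>) + 4 * e\<^sup>2 * (sin \<phi>)\<^sup>2"
  shows "(1 + x) powr (-p) \<le> 1 - 2 * p * e * sin (2 * \<phi>)
     + e\<^sup>2 * (2 * p * (p + 1) * (sin (2 * \<phi>))\<^sup>2 - 4 * p * (sin \<phi>)\<^sup>2) + 40 * \<bar>e\<bar>^3"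
    and "\<bar>x\<bar> \<le> 1/100"
proof -
  define S where "S = sin (2 * \<phi>)"
  define T where "T = (sin \<phi>)\<^sup>2"
  have S: "\<bar>S\<bar> \<le> 1" and T: "0 \<le> T" "T \<le> 1" by (auto simp: S_def T_def abs_square_le_1)
  have xe: "x = 2 * e * S + 4 * e\<^sup>2 * T" by (simp add: x_def S_def T_def)
  have e2: "e\<^sup>2 \<le> \<bar>e\<bar> / 460"
    using mult_left_mono[OF e, of "\<bar>e\<bar>"] by (simp add: power2_eq_square flip: abs_mult)
  have eS: "\<bar>e * S\<bar> \<le> \<bar>e\<bar>" using mult_left_mono[OF S, of "\<bar>e\<bar>"] by (simp add: abs_mult)
  have eT: "e\<^sup>2 * T \<le> e\<^sup>2" "0 \<le> e\<^sup>2 * T" using T mult_left_mono[OF T(2), of "e\<^sup>2"] by auto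
  \<comment> \<open>The quadratic part is at most (4/460) |e|, hence below 0.02 |e|.\<close>
  have ax: "\<bar>x\<bar> \<le> 202/100 * \<bar>e\<bar>"
    using eS eT e2 unfolding xe by (simp only: mult.assoc)
  then show x: "\<bar>x\<bar> \<le> 1/100" using e by linarith
  have "\<bar>x\<bar>^3 \<le> (202/100 * \<bar>e\<bar>)^3" using ax by (intro power_mono) auto
  also have "\<dots> \<le> 9 * \<bar>e\<bar>^3" by (simp add: power_mult_distrib power_divide)
  finally have x3: "\<bar>x\<bar>^3 \<le> 9 * \<bar>e\<bar>^3" .
  have e4: "e^4 \<le> \<bar>e\<bar>^3 / 460"
    using mult_left_mono[OF e, of "\<bar>e\<bar>^3"] by (simp add: power_abs eval_nat_numeral flip: abs_mult)
  have x2: "x\<^sup>2 = 4 * e\<^sup>2 * S\<^sup>2 + (16 * (e^3 * (S * T)) + 16 * (e^4 * T\<^sup>2))"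
    unfolding xe by (simp add: power2_eq_square eval_nat_numeral algebra_simps)
  have ST: "\<bar>S * T\<bar> \<le> 1" using S T by (simp add: abs_mult mult_le_one)
  have "e^3 * (S * T) \<le> \<bar>e\<bar>^3 * \<bar>S * T\<bar>"
    by (metis abs_ge_self abs_mult power_abs)
  also have "\<dots> \<le> \<bar>e\<bar>^3 * 1" using ST by (intro mult_left_mono) auto
  finally have a1: "e^3 * (S * T) \<le> \<bar>e\<bar>^3" by simp
  have "T\<^sup>2 \<le> 1" using T by (simp add: power_le_one)
  then have a2: "e^4 * T\<^sup>2 \<le> e^4" using mult_left_mono[of "T\<^sup>2" 1 "e^4"] by simp
  have k: "16 * (e^3 * (S * T)) + 16 * (e^4 * T\<^sup>2) \<le> 17 * \<bar>e\<bar>^3" 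
    using a1 a2 e4 zero_le_power[of "\<bar>e\<bar>" 3] by linarith
  have pp: "0 \<le> p * (p+1) / 2" "p * (p+1) / 2 \<le> 1"
    using p mult_mono[of p 1 "p+1" 2] by auto
  have "p * (p+1) / 2 * (16 * (e^3 * (S * T)) + 16 * (e^4 * T\<^sup>2)) \<le> p * (p+1) / 2 * (17 * \<bar>e\<bar>^3)"
    using k pp(1) by (rule mult_left_mono)
  also have "\<dots> \<le> 1 * (17 * \<bar>e\<bar>^3)" using pp(2) by (rule mult_right_mono) simp
  finally have q: "p * (p+1) / 2 * x\<^sup>2 \<le> 2 * p * (p+1) * e\<^sup>2 * S\<^sup>2 + 17 * \<bar>e\<bar>^3"
    unfolding x2 distrib_left[of "p * (p+1) / 2" "4 * e\<^sup>2 * S\<^sup>2"] by simp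
  have "(1 + x) powr (-p) \<le> 1 - p * x + p * (p + 1) / 2 * x\<^sup>2 + 2 * \<bar>x\<bar>^3"
    by (rule one_plus_powr_minus_upper_bound[OF p x])
  also have "\<dots> \<le> 1 - p * x + (2 * p * (p+1) * e\<^sup>2 * S\<^sup>2 + 17 * \<bar>e\<bar>^3) + 2 * (9 * \<bar>e\<bar>^3)"
    using q x3 by linarith
  also have "\<dots> \<le> 1 - 2 * p * e * S + e\<^sup>2 * (2 * p * (p + 1) * S\<^sup>2 - 4 * p * T) + 40 * \<bar>e\<bar>^3"
    unfolding xe by (simp add: algebra_simps)
  finally show "(1 + x) powr (-p) \<le> 1 - 2 * p * e * sin (2 * \<phi>)
     + e\<^sup>2 * (2 * p * (p + 1) * (sin (2 * \<phi>))\<^sup>2 - 4 * p * (sin \<phi>)\<^sup>2) + 40 * \<bar>e\<bar>^3"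
    by (simp add: S_def T_def)
qed

section \<open>The corrector and its small divisors\<close>

text \<open>The coefficients solve the cohomological equation of \<open>corrector_difference\<close> below.\<close>

definition corrector :: "real \<Rightarrow> real \<Rightarrow> complex \<Rightarrow> real" where
  "corrector \<theta> p u = Re (of_real (- 2 * p) / (cis (-2*\<theta>) - 1) * u
     + of_real (p * (p + 1)) / (cis (-4*\<theta>) - 1) * u\<^sup>2)"

text \<open>This chord length yields the divisors 2 |sin \<theta>| and 2 |sin 2\<theta>| of the
  corrector.\<close>

lemma norm_cis_minus_one: "norm (cis (2 * t) - 1) = 2 * \<bar>sin t\<bar>"
proof -
  have "(norm (cis (2 * t) - 1))\<^sup>2 = (2 * \<bar>sin t\<bar>)\<^sup>2"
    unfolding cmod_power2 by (simp add: cos_double sin_double power2_eq_square) 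
      (use sin_cos_squared_add[of t] in algebra)
  then show ?thesis by (rule power2_eq_imp_eq) auto
qed

text \<open>Rotation by -2\<theta> multiplies u and u^2 by \<open>cis (-2*\<theta>)\<close> and
  \<open>cis (-4*\<theta>)\<close>; dividing by these eigenvalues minus 1 inverts the difference
  operator. By |sin 2\<theta>| <= 2 |sin \<theta>| and p + 1 <= 2, the coefficients are at most
  2p/|sin 2\<theta>| and p/|sin 2\<theta>|. Their sum gives the 3; the factor |u + v| <= 2 from u^2
  - v^2 gives the 4.\<close>

lemma
  fixes \<theta> p :: real
  assumes D: "sin (2 * \<theta>) \<noteq> 0" and p: "0 \<le> p" "p \<le> 1"
  shows corrector_difference:
      "corrector \<theta> p (cis (-2*\<theta>) * cis (2*\<phi>)) = corrector \<theta> p (cis (2*\<phi>))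
        - 2 * p * cos (2*\<phi>) + p * (p + 1) * cos (4*\<phi>)"
    and corrector_bound: "norm u = 1 \<Longrightarrow> \<bar>corrector \<theta> p u\<bar> \<le> 3 * p / \<bar>sin (2*\<theta>)\<bar>"
    and corrector_lipschitz: "norm u = 1 \<Longrightarrow> norm v = 1 \<Longrightarrow>
        \<bar>corrector \<theta> p u - corrector \<theta> p v\<bar> \<le> 4 * p / \<bar>sin (2*\<theta>)\<bar> * norm (u - v)"
proof -
  define al where "al = complex_of_real (- 2 * p) / (cis (-2*\<theta>) - 1)"
  define be where "be = complex_of_real (p * (p + 1)) / (cis (-4*\<theta>) - 1)"
  have c: "corrector \<theta> p u = Re (al * u + be * u\<^sup>2)" for u
    by (simp add: corrector_def al_def be_def)
  have n1: "norm (cis (-2*\<theta>) - 1) = 2 * \<bar>sin \<theta>\<bar>" 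
    using norm_cis_minus_one[of "-\<theta>"] by simp
  have n2: "norm (cis (-4*\<theta>) - 1) = 2 * \<bar>sin (2*\<theta>)\<bar>" 
    using norm_cis_minus_one[of "-2*\<theta>"] by simp
  have s: "sin \<theta> \<noteq> 0" using D by (auto simp: sin_double)
  have nz: "cis (-2*\<theta>) - 1 \<noteq> 0" "cis (-4*\<theta>) - 1 \<noteq> 0"
    using n1 n2 s D by (metis abs_eq_0 mult_eq_0_iff norm_zero zero_neq_numeral)+
  have ss: "\<bar>sin (2*\<theta>)\<bar> \<le> 2 * \<bar>sin \<theta>\<bar>"
    using mult_left_mono[OF abs_cos_le_one[of \<theta>], of "2 * \<bar>sin \<theta>\<bar>"] by (simp add: sin_double abs_mult)
  have "norm al = 2 * p / (2 * \<bar>sin \<theta>\<bar>)" unfolding al_def norm_divide n1 using p by (simp add: norm_mult)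
  also have "\<dots> \<le> 2 * p / \<bar>sin (2*\<theta>)\<bar>"
    using ss D p by (intro divide_left_mono) (auto simp: s)
  finally have na: "norm al \<le> 2 * p / \<bar>sin (2*\<theta>)\<bar>" .
  have "norm be = p * (p+1) / (2 * \<bar>sin (2*\<theta>)\<bar>)"
    unfolding be_def norm_divide n2 using p by (simp only: norm_of_real) simp
  also have "\<dots> \<le> p * 2 / (2 * \<bar>sin (2*\<theta>)\<bar>)"
    using p by (intro divide_right_mono mult_left_mono) auto
  finally have nb: "norm be \<le> p / \<bar>sin (2*\<theta>)\<bar>" by simp
  have e1: "al * (cis (-2*\<theta>) * u) = al * u - of_real (2*p) * u" for u
  proof -
    have "al * (cis (-2*\<theta>) - 1) = - of_real (2*p)" using nz by (simp add: al_def)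
    then show ?thesis by (simp add: algebra_simps) (metis add_diff_cancel_left' diff_add_eq distrib_left mult.commute mult.left_commute uminus_add_conv_diff)
  qed
  have e2: "be * (cis (-2*\<theta>) * u)\<^sup>2 = be * u\<^sup>2 + of_real (p*(p+1)) * u\<^sup>2" for u
  proof -
    have *: "be * (cis (-4*\<theta>) - 1) = of_real (p*(p+1))" using nz by (simp add: be_def)
    have "(cis (-2*\<theta>))\<^sup>2 = cis (-4*\<theta>)" by (simp add: power2_eq_square cis_mult)
    then have "be * (cis (-2*\<theta>) * u)\<^sup>2 = be * (cis (-4*\<theta>) - 1) * u\<^sup>2 + be * u\<^sup>2"
      by (simp add: power_mult_distrib algebra_simps)
    then show ?thesis unfolding * by simp
  qed
  have d2: "(cis (2*\<phi>))\<^sup>2 = cis (4*\<phi>)" by (simp add: power2_eq_square cis_mult)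
  show "corrector \<theta> p (cis (-2*\<theta>) * cis (2*\<phi>)) = corrector \<theta> p (cis (2*\<phi>))
        - 2 * p * cos (2*\<phi>) + p * (p + 1) * cos (4*\<phi>)"
    unfolding c e1 e2 d2 by (simp del: of_real_mult of_real_add)
  show "\<bar>corrector \<theta> p u\<bar> \<le> 3 * p / \<bar>sin (2*\<theta>)\<bar>" if "norm u = 1"
  proof -
    have "\<bar>corrector \<theta> p u\<bar> \<le> norm (al * u + be * u\<^sup>2)" unfolding c by (rule abs_Re_le_cmod)
    also have "\<dots> \<le> norm al + norm be"
      using norm_triangle_ineq[of "al * u" "be * u\<^sup>2"] that by (simp add: norm_mult norm_power)
    also have "\<dots> \<le> 3 * p / \<bar>sin (2*\<theta>)\<bar>" using na nb by (simp add: add_divide_distrib[symmetric])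
    finally show ?thesis .
  qed
  show "\<bar>corrector \<theta> p u - corrector \<theta> p v\<bar> \<le> 4 * p / \<bar>sin (2*\<theta>)\<bar> * norm (u - v)"
    if "norm u = 1" "norm v = 1"
  proof -
    have "corrector \<theta> p u - corrector \<theta> p v = Re ((al + be * (u + v)) * (u - v))"
      unfolding c by (simp only: minus_complex.sel[symmetric]) (simp add: power2_eq_square algebra_simps)
    then have "\<bar>corrector \<theta> p u - corrector \<theta> p v\<bar> \<le> norm (al + be * (u + v)) * norm (u - v)"
      by (metis abs_Re_le_cmod norm_mult)
    moreover have "norm (al + be * (u + v)) \<le> norm al + norm be * norm (u + v)"
      by (metis norm_mult norm_triangle_ineq)
    moreover have "norm be * norm (u + v) \<le> norm be * 2"
      using norm_triangle_ineq[of u v] that by (intro mult_left_mono) auto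
    ultimately have "\<bar>corrector \<theta> p u - corrector \<theta> p v\<bar> \<le> (norm al + norm be * 2) * norm (u - v)"
      by (smt (verit) mult_right_mono norm_ge_zero)
    also have "\<dots> \<le> 4 * p / \<bar>sin (2*\<theta>)\<bar> * norm (u - v)"
    proof (rule mult_right_mono)
      have "norm al + norm be * 2 \<le> 2 * p / \<bar>sin (2*\<theta>)\<bar> + p / \<bar>sin (2*\<theta>)\<bar> * 2"
        using na nb by linarith
      then show "norm al + norm be * 2 \<le> 4 * p / \<bar>sin (2*\<theta>)\<bar>" by (simp flip: add_divide_distrib)
    qed simp
    finally show ?thesis .
  qed
qed

section \<open>One-step drift of the Lyapunov function\<close>

text \<open>The quotient \<open>\<eta> / cnj \<eta>\<close> is e^(2i\<phi>), which avoids choosing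
  an argument. At \<eta> = 0 the value is 0, since \<open>0 powr _ = 0\<close>.\<close>

definition lyapunov :: "real \<Rightarrow> real \<Rightarrow> real \<Rightarrow> complex \<Rightarrow> real" where
  "lyapunov \<theta> p s \<eta> = ((norm \<eta>)\<^sup>2) powr (-p) * (1 + s\<^sup>2 * corrector \<theta> p (\<eta> / cnj \<eta>))"

text \<open>A positive \<open>q\<close> changes only the modulus; with q = exp(-\<kappa>/2) it
  contributes the factor e^(p\<kappa>) to |\<eta>|^(-2p).\<close>

definition phase_step :: "real \<Rightarrow> real \<Rightarrow> real \<Rightarrow> complex \<Rightarrow> real \<Rightarrow> complex" where
  "phase_step \<theta> s q \<eta> w = of_real q * (cis (-\<theta>) * (\<eta> + of_real (2 * s * w * Im \<eta>)))"

text \<open>The bound is a quadratic polynomial in \<open>w\<close>, so its mean depends only on the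
  first two moments. To this end the corrector is evaluated at the noiseless rotated direction; the
  Lipschitz bound pays for this with the term containing 34.\<close>

lemma lyapunov_phase_step_le:
  fixes \<theta> p s q w e r \<phi> :: real
  assumes D: "sin (2 * \<theta>) \<noteq> 0" and p: "0 \<le> p" "p \<le> 1"
    and e: "\<bar>s * w\<bar> \<le> e" "e \<le> 1/460" and q: "0 < q" and r: "0 < r"
    and small: "s\<^sup>2 * (3 * p / \<bar>sin (2 * \<theta>)\<bar>) \<le> 1/3"
  shows "lyapunov \<theta> p s (phase_step \<theta> s q (rcis r \<phi>) w) \<le> (q\<^sup>2 * r\<^sup>2) powr (-p) *
     ((1 - 2 * p * (s * w) * sin (2 * \<phi>)
        + (s * w)\<^sup>2 * (2 * p * (p + 1) * (sin (2 * \<phi>))\<^sup>2 - 4 * p * (sin \<phi>)\<^sup>2 + 40 * e))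
      * (1 + s\<^sup>2 * corrector \<theta> p (cis (-2*\<theta>) * cis (2*\<phi>)))
      + 34 * p * s\<^sup>2 * e / \<bar>sin (2 * \<theta>)\<bar>)"
proof -
  define \<epsilon> where "\<epsilon> = s * w"
  define D where "D = \<bar>sin (2 * \<theta>)\<bar>"
  have Dpos: "D > 0" using D by (simp add: D_def)
  have \<epsilon>: "\<bar>\<epsilon>\<bar> \<le> e" "\<bar>\<epsilon>\<bar> \<le> 1/460" using e by (auto simp: \<epsilon>_def)
  have e0: "0 \<le> e" using \<epsilon> by linarith
  \<comment> \<open>The step multiplies \<eta> by q \<open>cis (-\<theta>)\<close> times this
    factor.\<close>
  define w1 where "w1 = 1 + of_real (2 * \<epsilon> * sin \<phi>) * cis (-\<phi>)"
  define x where "x = 2 * \<epsilon> * sin (2 * \<phi>) + 4 * \<epsilon>\<^sup>2 * (sin \<phi>)\<^sup>2"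
  define G1 where "G1 = corrector \<theta> p (cis (-2*\<theta>) * cis (2*\<phi>))"
  define G' where "G' = corrector \<theta> p (cis (-2*\<theta>) * cis (2*\<phi>) * (w1 / cnj w1))"
  define P where "P = 1 - 2 * p * \<epsilon> * sin (2 * \<phi>)
        + \<epsilon>\<^sup>2 * (2 * p * (p + 1) * (sin (2 * \<phi>))\<^sup>2 - 4 * p * (sin \<phi>)\<^sup>2 + 40 * e)"
  have x: "\<bar>x\<bar> \<le> 1/100" unfolding x_def by (rule growth_powr_upper_bound(2)[OF p \<epsilon>(2)])
  have "\<bar>\<epsilon>\<bar>^3 \<le> \<epsilon>\<^sup>2 * e"
    using mult_left_mono[OF \<epsilon>(1), of "\<epsilon>\<^sup>2"] by (simp add: power3_eq_cube power2_eq_square flip: abs_mult)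
  \<comment> \<open>One factor of the cubic error is replaced by its bound e, which keeps the
    expression quadratic in \<open>w\<close>.\<close>
  then have RP: "(1 + x) powr (-p) \<le> P"
    using growth_powr_upper_bound(1)[OF p \<epsilon>(2), of \<phi>] unfolding P_def x_def by (simp add: algebra_simps)
  have "(1 + x) powr (-p) \<le> (99/100) powr (-p)" using x p by (intro powr_mono2') auto
  also have "\<dots> \<le> (99/100) powr (-1)" using p by (intro powr_mono') auto
  finally have R2: "(1 + x) powr (-p) \<le> 2" by (simp add: powr_minus_divide)
  have nw: "(norm w1)\<^sup>2 = 1 + x"
  proof -
    have "(norm w1)\<^sup>2 = (1 + 2 * \<epsilon> * sin \<phi> * cos \<phi>)\<^sup>2 + (2 * \<epsilon> * sin \<phi> * sin \<phi>)\<^sup>2"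
      by (simp add: cmod_power2 w1_def)
    also have "\<dots> = 1 + x"
      unfolding x_def sin_double using sin_cos_squared_add[of \<phi>] by algebra
    finally show ?thesis .
  qed
  have nw1: "norm w1 \<ge> 99/100"
  proof (rule ccontr)
    assume "\<not> ?thesis"
    then have "(norm w1)\<^sup>2 < (99/100)\<^sup>2" by (intro power_strict_mono) auto
    then show False using nw x by (simp add: power2_eq_square)
  qed
  then have w0: "w1 \<noteq> 0" by auto
  have step: "phase_step \<theta> s q (rcis r \<phi>) w = of_real (q * r) * (cis (-\<theta>) * cis \<phi> * w1)"
  proof -
    have "cis \<phi> * w1 = cis \<phi> + of_real (2 * \<epsilon> * sin \<phi>) * (cis \<phi> * cis (-\<phi>))"
      unfolding w1_def by (simp only: distrib_left mult_1_right mult.left_commute)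
    also have "cis \<phi> * cis (-\<phi>) = 1" by (simp add: cis_mult)
    finally have "of_real r * (cis \<phi> * w1) = rcis r \<phi> + of_real (2 * s * w * Im (rcis r \<phi>))"
      by (simp add: rcis_def \<epsilon>_def algebra_simps)
    then have "phase_step \<theta> s q (rcis r \<phi>) w = of_real q * (cis (-\<theta>) * (of_real r * (cis \<phi> * w1)))"
      unfolding phase_step_def by (simp only:)
    then show ?thesis by (simp add: mult_ac)
  qed
  have n: "(norm (phase_step \<theta> s q (rcis r \<phi>) w))\<^sup>2 = (q\<^sup>2 * r\<^sup>2) * (1 + x)"
    unfolding step norm_mult power_mult_distrib nw by (simp add: norm_mult power_mult_distrib)
  have "phase_step \<theta> s q (rcis r \<phi>) w / cnj (phase_step \<theta> s q (rcis r \<phi>) w)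
      = (cis (-\<theta>) / cis \<theta>) * (cis \<phi> / cis (-\<phi>)) * (w1 / cnj w1)"
    unfolding step using q r by (simp add: cis_cnj)
  also have "\<dots> = cis (-2*\<theta>) * cis (2*\<phi>) * (w1 / cnj w1)" by (simp add: cis_divide)
  finally have v: "phase_step \<theta> s q (rcis r \<phi>) w / cnj (phase_step \<theta> s q (rcis r \<phi>) w)
      = cis (-2*\<theta>) * cis (2*\<phi>) * (w1 / cnj w1)" .
  \<comment> \<open>The noise turns the direction by at most 4e / 0.99, since |Im w1| = 2 |s w|
    sin^2 \<phi>.\<close>
  have "w1 / cnj w1 - 1 = (w1 - cnj w1) / cnj w1" using w0 by (simp add: diff_divide_distrib)
  then have "norm (w1 / cnj w1 - 1) = 2 * \<bar>Im w1\<bar> / norm w1"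
    by (simp add: norm_divide complex_diff_cnj norm_mult)
  also have "\<dots> = 4 * (\<bar>\<epsilon>\<bar> * (sin \<phi>)\<^sup>2) / norm w1" 
    by (simp add: w1_def abs_mult power2_eq_square flip: mult.assoc)
  also have "\<dots> \<le> 4 * (e * 1) / (99/100)"
    using nw1 \<epsilon> e0 by (intro frac_le mult_mono) (auto simp: abs_square_le_1)
  finally have d: "norm (w1 / cnj w1 - 1) \<le> 17/4 * e" using e0 by simp
  have "\<bar>G' - G1\<bar> \<le> 4 * p / D * norm (cis (-2*\<theta>) * cis (2*\<phi>) * (w1 / cnj w1) - cis (-2*\<theta>) * cis (2*\<phi>))"
    unfolding G'_def G1_def D_def using w0 
    by (intro corrector_lipschitz[OF D p]) (auto simp: norm_mult norm_divide)
  also have "norm (cis (-2*\<theta>) * cis (2*\<phi>) * (w1 / cnj w1) - cis (-2*\<theta>) * cis (2*\<phi>))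
      = norm (cis (-2*\<theta>) * cis (2*\<phi>) * (w1 / cnj w1 - 1))" by (simp add: algebra_simps)
  also have "\<dots> = norm (w1 / cnj w1 - 1)" by (simp add: norm_mult)
  also have "4 * p / D * norm (w1 / cnj w1 - 1) \<le> 4 * p / D * (17/4 * e)"
    using d p Dpos by (intro mult_left_mono) auto
  finally have G: "G' - G1 \<le> 17 * p * e / D" by (simp add: algebra_simps)
  have "\<bar>G1\<bar> \<le> 3 * p / D" unfolding G1_def D_def by (intro corrector_bound[OF D p]) (simp add: norm_mult)
  then have "s\<^sup>2 * \<bar>G1\<bar> \<le> s\<^sup>2 * (3 * p / D)" by (intro mult_left_mono) auto
  then have "\<bar>s\<^sup>2 * G1\<bar> \<le> 1/3" using small by (simp add: D_def abs_mult)
  \<comment> \<open>Nonnegativity allows the bound on (1 + x)^(-p) to be multiplied by this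
    factor.\<close>
  then have G1pos: "0 \<le> 1 + s\<^sup>2 * G1" by linarith
  have "(1 + x) powr (-p) * (1 + s\<^sup>2 * G') = (1 + x) powr (-p) * (1 + s\<^sup>2 * G1) + s\<^sup>2 * ((1 + x) powr (-p) * (G' - G1))"
    by (simp add: algebra_simps)
  also have "\<dots> \<le> P * (1 + s\<^sup>2 * G1) + s\<^sup>2 * (2 * (17 * p * e / D))"
  proof (intro add_mono mult_right_mono[OF RP G1pos] mult_left_mono)
    have "(1 + x) powr (-p) * (G' - G1) \<le> (1 + x) powr (-p) * (17 * p * e / D)"
      using G by (intro mult_left_mono) auto
    also have "\<dots> \<le> 2 * (17 * p * e / D)"
      using R2 p e0 Dpos by (intro mult_right_mono) auto
    finally show "(1 + x) powr (-p) * (G' - G1) \<le> 2 * (17 * p * e / D)" .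
  qed auto
  finally have main: "(1 + x) powr (-p) * (1 + s\<^sup>2 * G') \<le> P * (1 + s\<^sup>2 * G1) + 34 * p * s\<^sup>2 * e / D"
    by (simp add: algebra_simps)
  have "lyapunov \<theta> p s (phase_step \<theta> s q (rcis r \<phi>) w)
      = (q\<^sup>2 * r\<^sup>2) powr (-p) * ((1 + x) powr (-p) * (1 + s\<^sup>2 * G'))"
    unfolding lyapunov_def n v G'_def[symmetric] using x by (subst powr_mult) auto
  also have "\<dots> \<le> (q\<^sup>2 * r\<^sup>2) powr (-p) * (P * (1 + s\<^sup>2 * G1) + 34 * p * s\<^sup>2 * e / D)"
    using main by (intro mult_left_mono) auto
  finally show ?thesis unfolding P_def G1_def D_def \<epsilon>_def .
qed

text \<open>Per factor s^2 and in units of p t c^2 with t = e/D, the gap p(1-p) supplies 230. The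
  costs are at most 80 for 40 e, 1 for the product with the corrector, 34 for the direction error
  and 12 for \<kappa>: 127 in all.\<close>

lemma drift_inequality:
  fixes p s c D \<kappa> A G0 G1 :: real
  defines "e \<equiv> s * c"
  assumes p: "1/2 \<le> p" "p \<le> 1" and D: "0 < D" "D \<le> 1" and s: "0 < s" and c: "1 \<le> c"
    and e: "e \<le> D / 460" and gap: "1 - p = 230 * c\<^sup>2 * e / D"
    and \<kappa>: "0 \<le> \<kappa>" "\<kappa> \<le> 6 * c\<^sup>2 * e * s\<^sup>2 / D"
    and A: "\<bar>A\<bar> \<le> 4" and G0: "\<bar>G0\<bar> \<le> 3 * p / D" and G1: "\<bar>G1\<bar> \<le> 3 * p / D"
    and eq: "G1 = G0 - A - p * (1 - p)"
  shows "(1 + s\<^sup>2 * (A + 40 * e)) * (1 + s\<^sup>2 * G1) + 34 * p * s\<^sup>2 * e / D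
     \<le> (1 - p * \<kappa>) * (1 + s\<^sup>2 * G0)"
proof -
  define t where "t = e / D"
  have e0: "0 < e" using s c by (simp add: e_def)
  have t: "0 < t" "t \<le> 1/460" using e D e0 by (auto simp: t_def field_simps)
  have et: "e \<le> t" using D e0 by (simp add: t_def field_simps)
  have se: "s \<le> e" using s c by (simp add: e_def)
  have s2: "s\<^sup>2 / D \<le> t / 460"
  proof -
    have "s\<^sup>2 \<le> e * (1/460)" unfolding power2_eq_square using se s e D by (intro mult_mono) auto
    then show ?thesis using D by (simp add: t_def field_simps)
  qed
  have sG: "\<bar>s\<^sup>2 * G\<bar> \<le> 3 * p * (t / 460)" if "\<bar>G\<bar> \<le> 3 * p / D" for G
  proof -
    have "s\<^sup>2 * \<bar>G\<bar> \<le> s\<^sup>2 * (3 * p / D)" using that by (intro mult_left_mono) auto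
    also have "\<dots> = 3 * p * (s\<^sup>2 / D)" by simp
    also have "\<dots> \<le> 3 * p * (t / 460)" using s2 p by (intro mult_left_mono) auto
    finally show ?thesis by (simp add: abs_mult)
  qed
  have c2: "1 \<le> c\<^sup>2" using c by (simp add: one_le_power)
  have pt: "0 \<le> p * t" "p * t \<le> p * t * c\<^sup>2" using p t c2 mult_left_mono[OF c2, of "p * t"] by auto
  have "p * t \<le> 1 * (1/460)" using p t by (intro mult_mono) auto
  then have G0': "1 + s\<^sup>2 * G0 \<le> 2" using sG[OF G0] by linarith
  have "(A + 40 * e) * (s\<^sup>2 * G1) \<le> \<bar>A + 40 * e\<bar> * \<bar>s\<^sup>2 * G1\<bar>" by (metis abs_ge_self abs_mult)
  also have "\<dots> \<le> 5 * (3 * p * (t / 460))"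
    using sG[OF G1] A e0 et t by (intro mult_mono) auto
  finally have h1: "(A + 40 * e) * (s\<^sup>2 * G1) \<le> p * t" using pt by simp
  have "p * (\<kappa> * (1 + s\<^sup>2 * G0)) \<le> p * (6 * c\<^sup>2 * e * s\<^sup>2 / D * 2)"
    using G0' \<kappa> p mult_left_mono[OF G0' \<kappa>(1)] mult_right_mono[OF \<kappa>(2), of 2] by (intro mult_left_mono) linarith+
  then have h2: "p * \<kappa> * (1 + s\<^sup>2 * G0) \<le> s\<^sup>2 * (12 * (p * t * c\<^sup>2))" by (simp add: t_def algebra_simps)
  \<comment> \<open>Here p >= 1/2 enters, as 1 <= 2p.\<close>
  have h3: "40 * e \<le> 80 * (p * t)" using et p t mult_right_mono[OF p(1), of t] by linarith
  have "A + G1 = G0 - 230 * (p * t * c\<^sup>2)" unfolding eq gap t_def by (simp add: algebra_simps)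
  then have "(A + G1) + 40 * e + (A + 40 * e) * (s\<^sup>2 * G1) + 34 * (p * t) \<le> G0 - 12 * (p * t * c\<^sup>2)"
    using h1 h3 pt by linarith
  then have "s\<^sup>2 * ((A + G1) + 40 * e + (A + 40 * e) * (s\<^sup>2 * G1) + 34 * (p * t)) \<le> s\<^sup>2 * (G0 - 12 * (p * t * c\<^sup>2))"
    by (intro mult_left_mono) auto
  moreover have "(1 + s\<^sup>2 * (A + 40 * e)) * (1 + s\<^sup>2 * G1) + 34 * p * s\<^sup>2 * e / D
     = 1 + s\<^sup>2 * ((A + G1) + 40 * e + (A + 40 * e) * (s\<^sup>2 * G1) + 34 * (p * t))"
    by (simp add: t_def algebra_simps)
  moreover have "s\<^sup>2 * (G0 - 12 * (p * t * c\<^sup>2)) = s\<^sup>2 * G0 - s\<^sup>2 * (12 * (p * t * c\<^sup>2))"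
    by (simp add: right_diff_distrib)
  moreover have "(1 - p * \<kappa>) * (1 + s\<^sup>2 * G0) = 1 + s\<^sup>2 * G0 - p * \<kappa> * (1 + s\<^sup>2 * G0)"
    by (simp add: algebra_simps)
  ultimately show ?thesis using h2 by linarith
qed

text \<open>The corrector moves its factor by at most 1/3 from 1. The ratio of 4/3 to 2/3 becomes
  the prefactor 2 of the tail bound.\<close>

lemma lyapunov_bounds:
  assumes D: "sin (2 * \<theta>) \<noteq> 0" and p: "0 \<le> p" "p \<le> 1"
    and small: "s\<^sup>2 * (3 * p / \<bar>sin (2 * \<theta>)\<bar>) \<le> 1/3"
  shows "2/3 * ((norm \<eta>)\<^sup>2) powr (-p) \<le> lyapunov \<theta> p s \<eta>"
    and "lyapunov \<theta> p s \<eta> \<le> 4/3 * ((norm \<eta>)\<^sup>2) powr (-p)"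
proof -
  have "\<bar>s\<^sup>2 * corrector \<theta> p (\<eta> / cnj \<eta>)\<bar> \<le> 1/3" if "\<eta> \<noteq> 0"
  proof -
    have "\<bar>corrector \<theta> p (\<eta> / cnj \<eta>)\<bar> \<le> 3 * p / \<bar>sin (2 * \<theta>)\<bar>"
      using that by (intro corrector_bound[OF D p]) (simp add: norm_divide)
    then have "s\<^sup>2 * \<bar>corrector \<theta> p (\<eta> / cnj \<eta>)\<bar> \<le> s\<^sup>2 * (3 * p / \<bar>sin (2 * \<theta>)\<bar>)"
      by (intro mult_left_mono) auto
    then show ?thesis using small by (simp add: abs_mult)
  qed
  then have "\<eta> \<noteq> 0 \<Longrightarrow> 2/3 \<le> 1 + s\<^sup>2 * corrector \<theta> p (\<eta> / cnj \<eta>) \<and> 1 + s\<^sup>2 * corrector \<theta> p (\<eta> / cnj \<eta>) \<le> 4/3"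
    by fastforce
  then show "2/3 * ((norm \<eta>)\<^sup>2) powr (-p) \<le> lyapunov \<theta> p s \<eta>"
    and "lyapunov \<theta> p s \<eta> \<le> 4/3 * ((norm \<eta>)\<^sup>2) powr (-p)"
    unfolding lyapunov_def mult.commute[of "_ powr _"]
    by (cases "\<eta> = 0"; simp add: mult_right_mono)+
qed

text \<open>The supermartingale step: the mean of the quadratic bound is obtained from E X = 0 and E
  X^2 = 1, and the drift inequality applies to it.\<close>

lemma (in prob_space) nn_integral_lyapunov_le:
  fixes X :: "'a \<Rightarrow> real" and \<theta> p s c \<kappa> :: real and \<eta> :: complex
  assumes X: "X \<in> borel_measurable M" "expectation X = 0" "expectation (\<lambda>x. (X x)\<^sup>2) = 1"
    and bound: "AE x in M. \<bar>X x\<bar> < c"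
    and D: "sin (2 * \<theta>) \<noteq> 0" and s: "0 < s" and c: "1 \<le> c"
    and p: "1/2 \<le> p" and gap: "1 - p = 230 * c^3 * s / \<bar>sin (2 * \<theta>)\<bar>"
    and \<kappa>: "0 \<le> \<kappa>" "\<kappa> \<le> 6 * c^3 * s^3 / \<bar>sin (2 * \<theta>)\<bar>"
    and e: "s * c \<le> \<bar>sin (2 * \<theta>)\<bar> / 460"
    and small: "s\<^sup>2 * (3 * p / \<bar>sin (2 * \<theta>)\<bar>) \<le> 1/3"
  shows "(\<integral>\<^sup>+x. ennreal (lyapunov \<theta> p s (phase_step \<theta> s (exp (-\<kappa>/2)) \<eta> (X x))) \<partial>M) \<le> ennreal (lyapunov \<theta> p s \<eta>)"
proof (cases "\<eta> = 0")
  case True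
  then show ?thesis by (simp add: phase_step_def lyapunov_def)
next
  case False
  define r where "r = norm \<eta>"
  define \<phi> where "\<phi> = Arg \<eta>"
  have \<eta>: "\<eta> = rcis r \<phi>" by (simp add: r_def \<phi>_def rcis_cmod_Arg)
  have r: "0 < r" using False by (simp add: r_def)
  define D where "D = \<bar>sin (2 * \<theta>)\<bar>"
  have Dpos: "0 < D" "D \<le> 1" using D by (auto simp: D_def)
  have "0 \<le> 230 * c^3 * s / \<bar>sin (2 * \<theta>)\<bar>" using c s by simp
  then have p1: "p \<le> 1" using gap by linarith
  define G0 where "G0 = corrector \<theta> p (cis (2*\<phi>))"
  define G1 where "G1 = corrector \<theta> p (cis (-2*\<theta>) * cis (2*\<phi>))"
  define A where "A = 2 * p * (p + 1) * (sin (2 * \<phi>))\<^sup>2 - 4 * p * (sin \<phi>)\<^sup>2"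
  define Q where "Q = (exp (-\<kappa>/2)^2 * r\<^sup>2) powr (-p)"
  define b where "b = - 2 * p * s * sin (2 * \<phi>) * (1 + s\<^sup>2 * G1)"
  define d where "d = s\<^sup>2 * (A + 40 * (s * c)) * (1 + s\<^sup>2 * G1)"
  define a where "a = 1 + s\<^sup>2 * G1 + 34 * p * s\<^sup>2 * (s * c) / D"
  have small': "s * c \<le> 1/460" using e Dpos by (simp add: D_def[symmetric])
  have le: "lyapunov \<theta> p s (phase_step \<theta> s (exp (-\<kappa>/2)) \<eta> w) \<le> Q * (a + b * w + d * w\<^sup>2)" if "\<bar>w\<bar> < c" for w
  proof -
    have "\<bar>s * w\<bar> \<le> s * c" using that s by (simp add: abs_mult)
    from lyapunov_phase_step_le[OF D _ p1 this small' _ r small, of "exp (-\<kappa>/2)" \<phi>] p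
    have "lyapunov \<theta> p s (phase_step \<theta> s (exp (-\<kappa>/2)) \<eta> w) \<le> Q *
       ((1 - 2 * p * (s * w) * sin (2 * \<phi>) + (s * w)\<^sup>2 * (A + 40 * (s * c))) * (1 + s\<^sup>2 * G1)
         + 34 * p * s\<^sup>2 * (s * c) / D)"
      unfolding \<eta> Q_def A_def G1_def D_def by simp
    also have "\<dots> = Q * (a + b * w + d * w\<^sup>2)"
      unfolding a_def b_def d_def by (simp add: algebra_simps power_mult_distrib)
    finally show ?thesis .
  qed
  have nonneg: "0 \<le> lyapunov \<theta> p s \<zeta>" for \<zeta>
    by (rule order_trans[OF _ lyapunov_bounds(1)[OF D _ p1 small]]) (use p in auto)
  have int1: "integrable M X"
    using X(1) bound by (intro integrable_const_bound[where B = c]) auto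
  have int2: "integrable M (\<lambda>x. (X x)\<^sup>2)"
  proof (rule integrable_const_bound[where B = "c\<^sup>2"])
    show "AE x in M. norm ((X x)\<^sup>2) \<le> c\<^sup>2"
      using bound by eventually_elim (use c in \<open>simp add: abs_le_square_iff[symmetric]\<close>)
  qed (use X in simp)
  have "(\<integral>\<^sup>+x. ennreal (lyapunov \<theta> p s (phase_step \<theta> s (exp (-\<kappa>/2)) \<eta> (X x))) \<partial>M)
      \<le> (\<integral>\<^sup>+x. ennreal (Q * (a + b * X x + d * (X x)\<^sup>2)) \<partial>M)"
  proof (rule nn_integral_mono_AE)
    show "AE x in M. ennreal (lyapunov \<theta> p s (phase_step \<theta> s (exp (-\<kappa>/2)) \<eta> (X x)))
      \<le> ennreal (Q * (a + b * X x + d * (X x)\<^sup>2))"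
      using bound by eventually_elim (intro ennreal_leI le)
  qed
  also have "\<dots> = ennreal (expectation (\<lambda>x. Q * (a + b * X x + d * (X x)\<^sup>2)))"
  proof (rule nn_integral_eq_integral)
    \<comment> \<open>The polynomial dominates the nonnegative Lyapunov function almost
      everywhere.\<close>
    show "AE x in M. 0 \<le> Q * (a + b * X x + d * (X x)\<^sup>2)"
      using bound by eventually_elim (meson le nonneg order_trans)
  qed (use int1 int2 in simp)
  also have "expectation (\<lambda>x. Q * (a + b * X x + d * (X x)\<^sup>2)) = Q * (a + d)"
    using int1 int2 X by (simp add: prob_space)
  also have "Q * (a + d) \<le> Q * ((1 - p * \<kappa>) * (1 + s\<^sup>2 * G0))"
  proof (rule mult_left_mono)
    have "(1 + s\<^sup>2 * (A + 40 * (s * c))) * (1 + s\<^sup>2 * G1) + 34 * p * s\<^sup>2 * (s * c) / D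
        \<le> (1 - p * \<kappa>) * (1 + s\<^sup>2 * G0)"
    proof (rule drift_inequality[OF p p1 Dpos s c])
      show "s * c \<le> D / 460" using e by (simp add: D_def)
      show "1 - p = 230 * c\<^sup>2 * (s * c) / D" unfolding gap D_def by (simp add: power2_eq_square power3_eq_cube)
      show "\<kappa> \<le> 6 * c\<^sup>2 * (s * c) * s\<^sup>2 / D"
        using \<kappa>(2) unfolding D_def by (simp add: power2_eq_square power3_eq_cube mult_ac)
      show "\<bar>G0\<bar> \<le> 3 * p / D" "\<bar>G1\<bar> \<le> 3 * p / D"
        unfolding G0_def G1_def D_def using p by (intro corrector_bound[OF D _ p1]; simp add: norm_mult)+
      show "\<bar>A\<bar> \<le> 4"
      proof -
        have "p * (p + 1) \<le> 1 * 2" using p p1 by (intro mult_mono) auto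
        then have "p * (p + 1) * (sin (2 * \<phi>))\<^sup>2 \<le> 2 * 1" using p
          by (intro mult_mono) (auto simp: abs_square_le_1)
        moreover have "p * (sin \<phi>)\<^sup>2 \<le> 1 * 1" using p p1
          by (intro mult_mono) (auto simp: abs_square_le_1)
        moreover have "0 \<le> p * (p + 1) * (sin (2 * \<phi>))\<^sup>2" "0 \<le> p * (sin \<phi>)\<^sup>2" using p by auto
        ultimately show ?thesis unfolding A_def by (simp only: mult.assoc abs_le_iff) linarith
      qed
      \<comment> \<open>The double-angle formulas turn 2p cos 2\<phi> - p(p+1) cos 4\<phi> into A +
        p(1-p), which isolates the negative drift.\<close>
      have cos: "cos (2 * \<phi>) = 1 - 2 * (sin \<phi>)\<^sup>2" "cos (4 * \<phi>) = 1 - 2 * (sin (2 * \<phi>))\<^sup>2"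
        using cos_double_sin[of \<phi>] cos_double_sin[of "2 * \<phi>"] by simp_all
      have "G1 = G0 - 2 * p * cos (2 * \<phi>) + p * (p + 1) * cos (4 * \<phi>)"
        unfolding G0_def G1_def using p by (intro corrector_difference[OF D _ p1]) simp
      then show "G1 = G0 - A - p * (1 - p)" unfolding cos A_def by (simp add: algebra_simps)
    qed (use \<kappa> in auto)
    then show "a + d \<le> (1 - p * \<kappa>) * (1 + s\<^sup>2 * G0)" unfolding a_def d_def by (simp add: algebra_simps)
  qed (simp add: Q_def)
  also have "\<dots> \<le> lyapunov \<theta> p s \<eta>"
  proof -
    have "exp (-\<kappa>/2)^2 = exp (-\<kappa>)" by (simp flip: exp_double)
    then have Q: "Q = exp (p * \<kappa>) * (r\<^sup>2) powr (-p)" unfolding Q_def using r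
      by (subst powr_mult) (auto simp: exp_powr_real mult.commute)
    have "\<eta> / cnj \<eta> = cis (2 * \<phi>)" unfolding \<eta> using r by (simp add: rcis_def cis_cnj cis_divide)
    then have L: "lyapunov \<theta> p s \<eta> = (r\<^sup>2) powr (-p) * (1 + s\<^sup>2 * G0)"
      by (simp add: lyapunov_def r_def G0_def)
    \<comment> \<open>The rescaling contributes e^(p\<kappa>), and the reserved factor 1 - p\<kappa>
      compensates it.\<close>
    have "1 - p * \<kappa> \<le> exp (- (p * \<kappa>))" using exp_ge_add_one_self[of "- (p * \<kappa>)"] by simp
    then have "exp (p * \<kappa>) * (1 - p * \<kappa>) \<le> 1" by (simp add: exp_minus field_simps)
    then have "exp (p * \<kappa>) * (1 - p * \<kappa>) * lyapunov \<theta> p s \<eta> \<le> 1 * lyapunov \<theta> p s \<eta>"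
      by (rule mult_right_mono) (rule nonneg)
    then show ?thesis unfolding L Q by (simp add: mult_ac)
  qed
  finally show ?thesis by (simp add: ennreal_leI)
qed

section \<open>The tail bound\<close>

lemma measurable_phase_step:
  "(\<lambda>(\<eta>, w). phase_step \<theta> s q \<eta> w) \<in> borel_measurable (borel \<Otimes>\<^sub>M borel)"
  unfolding borel_prod case_prod_beta phase_step_def
  by (intro borel_measurable_continuous_onI continuous_intros)

lemma measurable_lyapunov: "lyapunov \<theta> p s \<in> borel_measurable borel"
proof -
  have [measurable]: "corrector \<theta> p \<in> borel_measurable borel" "cnj \<in> borel_measurable borel"
    unfolding corrector_def by (intro borel_measurable_continuous_onI continuous_intros)+
  show ?thesis unfolding lyapunov_def by measurable
qed

text \<open>Rescaling by \<open>exp (-\<kappa>/2)\<close> in each step builds the drift term \<open>\<kappa> n\<close> into the state, and the initial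
  normalisation divides by \<open>Y\<^sub>1\<close>.\<close>

lemma chain_phase_step_eq:
  "chain (phase_step \<theta> s (exp (-\<kappa>/2))) (\<lambda>w. sgn (phase_step \<theta> s 1 (cis (-\<theta>)) w)) om n
    = of_real (exp (-\<kappa> * n / 2) / norm (phase \<theta> s om 1)) * phase \<theta> s om (Suc n)"
proof (induction n)
  case 0
  show ?case by (simp add: phase_step_def sgn_eq scaleR_conv_of_real)
next
  case (Suc n)
  \<comment> \<open>The step is homogeneous over the reals, so the accumulated scale factor passes
    through it.\<close>
  have lin: "phase_step \<theta> s q (of_real r * \<eta>) w = of_real (q * r) * (cis (-\<theta>) * (\<eta> + of_real (2 * s * w * Im \<eta>)))"
    for q r \<eta> w by (simp add: phase_step_def algebra_simps)
  have "exp (-\<kappa>/2) * (exp (-\<kappa> * n / 2) / norm (phase \<theta> s om 1)) = exp (-\<kappa> * Suc n / 2) / norm (phase \<theta> s om 1)"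
    by (simp add: field_simps flip: exp_add)
  then show ?case unfolding chain.simps(2) Suc lin by (simp only: phase.simps(2)[of \<theta> s om "Suc n"])
qed

theorem theorem3:
  fixes M :: "'a measure" and \<omega> :: "nat \<Rightarrow> 'a \<Rightarrow> real"
    and \<theta> c0 \<sigma> \<kappa> B :: real
  assumes "prob_space M"
    and "0 < \<theta>" "\<theta> < pi" "sin (2 * \<theta>) \<noteq> 0"
    and "\<And>j. \<omega> j \<in> borel_measurable M"
    and "prob_space.indep_vars M (\<lambda>_. borel) \<omega> {1..}"
    and "\<And>j. j \<ge> 1 \<Longrightarrow> distr M borel (\<omega> j) = distr M borel (\<omega> 1)"
    and "\<And>j. j \<ge> 1 \<Longrightarrow> integral\<^sup>L M (\<omega> j) = 0"
    and "\<And>j. j \<ge> 1 \<Longrightarrow> integral\<^sup>L M (\<lambda>x. (\<omega> j x)\<^sup>2) = 1"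
    and "\<And>j. j \<ge> 1 \<Longrightarrow> AE x in M. \<bar>\<omega> j x\<bar> < c0"
    and "0 < \<sigma>" "\<sigma> \<le> 2 * sin \<theta> * \<bar>sin (2 * \<theta>)\<bar> / (460 * c0 ^ 3)"
    and "0 \<le> \<kappa>"
    and "\<kappa> \<le> 6 * c0 ^ 3 * (1 / (2 * sin \<theta>)) ^ 3 * \<sigma> ^ 3 / \<bar>sin (2 * \<theta>)\<bar>"
    and "0 < B"
  shows "measure M {x \<in> space M. \<exists>n::nat \<ge> 1.
            (ln (Yk \<theta> (2 * cos \<theta>) \<sigma> (\<lambda>j. \<omega> j x) n) + \<kappa> * real n)
              - (ln (Yk \<theta> (2 * cos \<theta>) \<sigma> (\<lambda>j. \<omega> j x) 1) + \<kappa>) \<ge> B}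
         \<le> 2 * exp (- B * (1 - 230 * c0 ^ 3 * \<sigma> / (2 * sin \<theta> * \<bar>sin (2 * \<theta>)\<bar>)))"
proof -
  interpret prob_space M by fact
  define S where "S = sin \<theta>"
  define D where "D = \<bar>sin (2 * \<theta>)\<bar>"
  define s where "s = \<sigma> / (2 * S)"
  \<comment> \<open>This is exactly the exponent of the claimed bound.\<close>
  define p where "p = 1 - 230 * c0^3 * s / D"
  define L where "L = 2/3 * exp (p * B)"
  \<comment> \<open>Zero is excluded because there the Lyapunov function vanishes and could not
    exceed \<open>L\<close>.\<close>
  define A where "A = {\<eta>::complex. \<eta> \<noteq> 0 \<and> (norm \<eta>)\<^sup>2 \<le> exp (-B)}"
  let ?F = "phase_step \<theta> s (exp (-\<kappa>/2))" and ?i = "\<lambda>w. sgn (phase_step \<theta> s 1 (cis (-\<theta>)) w)"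
  note D0 = assms(4)
  have S: "0 < S" unfolding S_def using assms(2,3) by (rule sin_gt_zero)
  have D: "0 < D" "D \<le> 1" using D0 by (auto simp: D_def)
  have s: "0 < s" using assms S by (simp add: s_def)
  \<comment> \<open>A variable of second moment 1 cannot be bounded by less than 1.\<close>
  have c0: "1 \<le> c0"
  proof -
    have "AE x in M. 0 < c0" using assms(10)[of 1, simplified] by eventually_elim linarith
    then have pos: "0 < c0" by (simp add: eventually_const_iff ae_filter_eq_bot_iff emeasure_space_1)
    have "expectation (\<lambda>x. (\<omega> 1 x)\<^sup>2) \<le> c0\<^sup>2"
    proof (rule integral_le_const)
      show *: "AE x in M. (\<omega> 1 x)\<^sup>2 \<le> c0\<^sup>2"
        using assms(10)[of 1, simplified] by eventually_elim (use pos in \<open>simp add: abs_le_square_iff[symmetric]\<close>)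
      then show "integrable M (\<lambda>x. (\<omega> 1 x)\<^sup>2)"
        using assms(5) by (intro integrable_const_bound[where B = "c0\<^sup>2"]) auto
    qed
    then have "1\<^sup>2 \<le> c0\<^sup>2" using assms(9)[of 1] by simp
    then show ?thesis by (rule power2_le_imp_le) (use pos in simp)
  qed
  \<comment> \<open>This restates the bound on \<sigma>; since 230/460 = 1/2, it yields p >=
    1/2.\<close>
  have c3: "c0^3 * s \<le> D / 460"
    using assms(12) c0 S unfolding s_def S_def[symmetric] D_def[symmetric] by (simp add: field_simps)
  have "c0 * s \<le> c0^3 * s" using c0 s by (intro mult_right_mono self_le_power) auto
  then have e: "s * c0 \<le> D / 460" using c3 by (simp add: mult.commute)
  have p1: "p \<le> 1" using s c0 D by (simp add: p_def)
  have p2: "1/2 \<le> p" using c3 D by (simp add: p_def field_simps)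
  have "s \<le> s * c0" using s c0 by simp
  then have sD: "s \<le> D / 460" using e by simp
  have small: "s\<^sup>2 * (3 * p / D) \<le> 1/3"
  proof -
    have "s\<^sup>2 * (3 * p / D) = (s / D) * (3 * p * s)" by (simp add: power2_eq_square)
    also have "\<dots> \<le> (1/460) * (3 * 1 * 1)"
      using sD D s p1 p2 by (intro mult_mono) (auto simp: field_simps)
    finally show ?thesis by simp
  qed
  have \<kappa>: "\<kappa> \<le> 6 * c0^3 * s^3 / D"
    using assms(14) unfolding s_def S_def D_def by (simp add: power_divide mult_ac)
  have "prob {x \<in> space M. \<exists>n. chain ?F ?i (\<lambda>j. \<omega> j x) n \<in> A} \<le> (4/3) / L"
  proof (rule prob_chain_hits_le[where V = "\<lambda>\<eta>. ennreal (lyapunov \<theta> p s \<eta>)"])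
    show "(\<lambda>(\<eta>, w). ?F \<eta> w) \<in> borel_measurable (borel \<Otimes>\<^sub>M borel)" by (rule measurable_phase_step)
    show "?i \<in> borel_measurable borel"
    proof -
      have [measurable]: "(sgn :: complex \<Rightarrow> complex) \<in> borel_measurable borel"
        unfolding sgn_div_norm by measurable
      have [measurable]: "phase_step \<theta> s 1 (cis (-\<theta>)) \<in> borel_measurable borel"
        unfolding phase_step_def by (intro borel_measurable_continuous_onI continuous_intros)
      show ?thesis by measurable
    qed
    show "indep_vars (\<lambda>_. borel) \<omega> {1..}" by fact
    show "(\<lambda>\<eta>. ennreal (lyapunov \<theta> p s \<eta>)) \<in> borel_measurable borel"
      using measurable_lyapunov by measurable
    show "(\<integral>\<^sup>+x. ennreal (lyapunov \<theta> p s (?F \<eta> (\<omega> (Suc j) x))) \<partial>M) \<le> ennreal (lyapunov \<theta> p s \<eta>)" for \<eta> j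
      using assms e p2 s c0 small \<kappa> by (intro nn_integral_lyapunov_le[where c = c0]) (auto simp: D_def p_def)
    show "A \<in> sets borel" unfolding A_def by measurable
    show "0 < L" by (simp add: L_def)
    show "ennreal L \<le> ennreal (lyapunov \<theta> p s \<eta>)" if "\<eta> \<in> A" for \<eta>
    proof (rule ennreal_leI)
      have "exp (p * B) = exp (-B) powr (-p)" by (simp add: exp_powr_real)
      also have "\<dots> \<le> ((norm \<eta>)\<^sup>2) powr (-p)" using that p2 by (intro powr_mono2') (auto simp: A_def)
      finally show "L \<le> lyapunov \<theta> p s \<eta>"
        using lyapunov_bounds(1)[OF D0 _ p1 small[unfolded D_def], of \<eta>] p2 by (simp add: L_def)
    qed
    show "ennreal (lyapunov \<theta> p s (?i w)) \<le> ennreal (4/3)" for w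
    proof (rule ennreal_leI)
      \<comment> \<open>The chain starts on the unit circle or, formally, at 0, so the initial value
        is at most 4/3.\<close>
      have "norm (?i w) = 0 \<or> norm (?i w) = 1" by (simp add: norm_sgn)
      then have "((norm (?i w))\<^sup>2) powr (-p) \<le> 1" by auto
      then show "lyapunov \<theta> p s (?i w) \<le> 4/3"
        using lyapunov_bounds(2)[OF D0 _ p1 small[unfolded D_def], of "?i w"] p2 by linarith
    qed
  qed simp
  also have "(4/3) / L = 2 * exp (- B * (1 - 230 * c0 ^ 3 * \<sigma> / (2 * sin \<theta> * \<bar>sin (2 * \<theta>)\<bar>)))"
  proof -
    have "(4/3) / L = 2 * exp (- B * p)" by (simp add: L_def exp_minus field_simps)
    then show ?thesis by (simp add: p_def s_def S_def D_def)
  qed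
  also have "{x \<in> space M. \<exists>n. chain ?F ?i (\<lambda>j. \<omega> j x) n \<in> A} = {x \<in> space M. \<exists>n::nat \<ge> 1.
            (ln (Yk \<theta> (2 * cos \<theta>) \<sigma> (\<lambda>j. \<omega> j x) n) + \<kappa> * real n)
              - (ln (Yk \<theta> (2 * cos \<theta>) \<sigma> (\<lambda>j. \<omega> j x) 1) + \<kappa>) \<ge> B}"
  proof -
    \<comment> \<open>State n belongs to Y_(n+1), and \<kappa>(n+1) - \<kappa> = \<kappa> n is the
      drift that the rescaling has accumulated.\<close>
    have hit: "chain ?F ?i om n \<in> A \<longleftrightarrow> (ln (Yk \<theta> (2 * cos \<theta>) \<sigma> om (Suc n)) + \<kappa> * real (Suc n))
              - (ln (Yk \<theta> (2 * cos \<theta>) \<sigma> om 1) + \<kappa>) \<ge> B" for om n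
    proof -
      define a where "a = (norm (phase \<theta> s om 1))\<^sup>2"
      define b where "b = (norm (phase \<theta> s om (Suc n)))\<^sup>2"
      have ab: "0 < a" "0 < b" unfolding a_def b_def using phase_nonzero by (auto simp del: phase.simps)
      have Y: "Yk \<theta> (2 * cos \<theta>) \<sigma> om 1 = S / a" "Yk \<theta> (2 * cos \<theta>) \<sigma> om (Suc n) = S / b"
        using Yk_eq[of \<theta> \<sigma> om] S unfolding a_def b_def s_def S_def by auto
      have "exp (-\<kappa> * n / 2)^2 = exp (-\<kappa> * n)" by (simp flip: exp_double)
      then have nrm: "(norm (chain ?F ?i om n))\<^sup>2 = exp (-\<kappa> * n) * b / a"
        unfolding chain_phase_step_eq a_def b_def norm_mult norm_of_real power_mult_distrib power2_abs power_divide
        by simp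
      have nz: "chain ?F ?i om n \<noteq> 0"
        using nrm ab by auto
      have "chain ?F ?i om n \<in> A \<longleftrightarrow> exp (-\<kappa> * n) * b / a \<le> exp (-B)"
        unfolding A_def mem_Collect_eq nrm using nz by blast
      also have "\<dots> \<longleftrightarrow> ln (exp (-\<kappa> * n) * b / a) \<le> -B"
        using ab by (subst ln_le_cancel_iff[symmetric]) auto
      also have "\<dots> \<longleftrightarrow> B \<le> ln (S / b) - ln (S / a) + \<kappa> * n"
        using ab S by (simp add: ln_mult ln_div) linarith
      finally show ?thesis unfolding Y by (simp add: algebra_simps)
    qed
    have "(\<exists>n::nat\<ge>1. P n) \<longleftrightarrow> (\<exists>n. P (Suc n))" for P
      by (metis One_nat_def Suc_le_D Suc_le_mono le0)
    then show ?thesis unfolding hit by auto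
  qed
  finally show ?thesis .
qed

end
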